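(* A trunc $G$ is simple if and only if it is bounded and bounded away from $0$.
   Context: All vector lattices are real. A truncation on an archimedean vector lattice $G$ is a unary operation $g\mapsto\overline g$ on $G^+$ such that for all $g,h\in G^+$: $g\wedge\overline h\le\overline g\le g$; if $\overline g=0$ then $g=0$; if $ng=\overline{ng}$ for all positive integers $n$ then $g=0$. A trunc is an archimedean vector lattice with a truncation. $\overline G=\{\overline g:g\in G^+\}$. For $f,g\in G^+$, $f$ is a component of $g$ if $f\le g$ and $f\wedge(g-f)=0$. A unital component of $G$ is an element $u\in\overline G$ such that $u\wedge g$ is a component of $g$ for every $g\in\overline G$; $\mathcal{UC}(G)$ is the set of unital components. $G$ is simple if every element is a finite real linear combination of unital components. $G$ is bounded if for every $g\in G^+$ there is a positive integer $n$ with $g\le n\overline g$. An element $0<g\in G$ is bounded away from $0$ if $\overline{ng}\in\mathcal{UC}(G)$ for some positive integer $n$; $G$ is bounded away from $0$ if every $0<g\in G$ is bounded away from $0$. *)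

theory Defs
  imports Complex_Main "HOL-Library.Lattice_Algebras"
begin

class vector_lattice = ordered_real_vector + lattice_ab_group_add

class archimedean_vector_lattice = vector_lattice +
  assumes archimedean:
    "0 \<le> f \<Longrightarrow> 0 \<le> g \<Longrightarrow> (\<And>n::nat. 0 < n \<Longrightarrow> real n *\<^sub>R f \<le> g) \<Longrightarrow> f = 0"

(* A truncation is an operation on the positive cone only; it is represented by a total
   function whose values outside the cone are irrelevant: here and in all definitions below
   it is applied to elements of the cone only. *)
locale trunc =
  fixes t :: "'a::archimedean_vector_lattice \<Rightarrow> 'a"
  assumes trunc_nonneg: "0 \<le> g \<Longrightarrow> 0 \<le> t g"
    and inf_trunc_le: "0 \<le> g \<Longrightarrow> 0 \<le> h \<Longrightarrow> inf g (t h) \<le> t g"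
    and trunc_le: "0 \<le> g \<Longrightarrow> t g \<le> g"
    and trunc_eq_0: "0 \<le> g \<Longrightarrow> t g = 0 \<Longrightarrow> g = 0"
    and trunc_multiples:
      "0 \<le> g \<Longrightarrow> (\<And>n::nat. 0 < n \<Longrightarrow> real n *\<^sub>R g = t (real n *\<^sub>R g)) \<Longrightarrow> g = 0"

definition truncated_elements :: "('a::archimedean_vector_lattice \<Rightarrow> 'a) \<Rightarrow> 'a set" where
  "truncated_elements t = t ` {g. 0 \<le> g}"

definition is_component :: "'a::vector_lattice \<Rightarrow> 'a \<Rightarrow> bool" where
  "is_component f g \<longleftrightarrow> 0 \<le> f \<and> 0 \<le> g \<and> f \<le> g \<and> inf f (g - f) = 0"

definition unital_components :: "('a::archimedean_vector_lattice \<Rightarrow> 'a) \<Rightarrow> 'a set" where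
  "unital_components t =
    {u \<in> truncated_elements t. \<forall>g \<in> truncated_elements t. is_component (inf u g) g}"

definition simple_trunc :: "('a::archimedean_vector_lattice \<Rightarrow> 'a) \<Rightarrow> bool" where
  "simple_trunc t \<longleftrightarrow> (\<forall>g. g \<in> span (unital_components t))"

definition bounded_trunc :: "('a::archimedean_vector_lattice \<Rightarrow> 'a) \<Rightarrow> bool" where
  "bounded_trunc t \<longleftrightarrow> (\<forall>g. 0 \<le> g \<longrightarrow> (\<exists>n::nat. 0 < n \<and> g \<le> real n *\<^sub>R t g))"

definition elt_bounded_away :: "('a::archimedean_vector_lattice \<Rightarrow> 'a) \<Rightarrow> 'a \<Rightarrow> bool" where
  "elt_bounded_away t g \<longleftrightarrow>
    0 < g \<and> (\<exists>n::nat. 0 < n \<and> t (real n *\<^sub>R g) \<in> unital_components t)"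

definition trunc_bounded_away :: "('a::archimedean_vector_lattice \<Rightarrow> 'a) \<Rightarrow> bool" where
  "trunc_bounded_away t \<longleftrightarrow> (\<forall>g. 0 < g \<longrightarrow> elt_bounded_away t g)"

end

theory Submission imports Defs begin

text \<open>
  Think of \<open>G\<close> as functions with \<open>t g = g \<and> 1\<close>; unital components are then the indicator
  functions of certain clopen sets. If \<open>G\<close> is simple, every \<open>g \<ge> 0\<close> is a positive combination
  of disjoint unital components, so it lies between two positive multiples of a single unital
  component \<open>u\<close>, and \<open>t (c g) = u\<close> for all large \<open>c\<close>.

  Conversely, given \<open>g > 0\<close>, choose a unital component \<open>u\<close> with \<open>g \<le> N u\<close>. Being bounded away
  from \<open>0\<close>, the positive and negative parts of \<open>g - x u\<close> show that \<open>g\<close> omits the values close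
  to, but different from, \<open>x\<close>; hence \<open>g \<and> b u - g \<and> a u\<close> is a linear combination of unital
  components whenever \<open>a \<le> x \<le> b\<close> and \<open>b - a\<close> is small. These differences telescope, so
  compactness of \<open>[0, N]\<close> gives the same for \<open>g = g \<and> N u - g \<and> 0 u\<close>.
\<close>

declare diff_inf_eq_sup [simp del]

section \<open>Vector lattices\<close>

lemma scaleR_inf_pos:
  fixes a b :: "'a::vector_lattice"
  assumes "0 < c"
  shows "c *\<^sub>R inf a b = inf (c *\<^sub>R a) (c *\<^sub>R b)"
proof (rule order.antisym)
  show "c *\<^sub>R inf a b \<le> inf (c *\<^sub>R a) (c *\<^sub>R b)"
    using assms by (simp add: scaleR_left_mono)
  have "inverse c *\<^sub>R inf (c *\<^sub>R a) (c *\<^sub>R b) \<le> inverse c *\<^sub>R (c *\<^sub>R a)"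
    "inverse c *\<^sub>R inf (c *\<^sub>R a) (c *\<^sub>R b) \<le> inverse c *\<^sub>R (c *\<^sub>R b)"
    using assms by (intro scaleR_left_mono; simp)+
  then have "inverse c *\<^sub>R inf (c *\<^sub>R a) (c *\<^sub>R b) \<le> inf a b"
    using assms by simp
  then have "c *\<^sub>R (inverse c *\<^sub>R inf (c *\<^sub>R a) (c *\<^sub>R b)) \<le> c *\<^sub>R inf a b"
    using assms by (intro scaleR_left_mono) auto
  then show "inf (c *\<^sub>R a) (c *\<^sub>R b) \<le> c *\<^sub>R inf a b"
    using assms by simp
qed

lemma inf_add_le:
  fixes a b c :: "'a::lattice_ab_group_add"
  assumes "0 \<le> a" "0 \<le> b" "0 \<le> c"
  shows "inf a (b + c) \<le> inf a b + inf a c"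
proof -
  have "inf a (b + c) \<le> a + inf a c"
    using assms by (simp add: add_increasing2 le_infI1)
  moreover have "inf a (b + c) \<le> b + inf a c"
    using assms by (simp add: add_inf_distrib_left add_increasing le_infI1)
  ultimately show ?thesis
    by (simp add: add_inf_distrib_right)
qed

lemma inf_add_eq_0:
  fixes a b c :: "'a::lattice_ab_group_add"
  assumes "0 \<le> a" "0 \<le> b" "0 \<le> c" "inf a b = 0" "inf a c = 0"
  shows "inf a (b + c) = 0"
  using inf_add_le[OF assms(1-3)] assms by (intro order.antisym) auto

lemma inf_eq_0_mono:
  fixes a b :: "'a::lattice_ab_group_add"
  assumes "inf a b = 0" "0 \<le> a'" "a' \<le> a" "0 \<le> b'" "b' \<le> b"
  shows "inf a' b' = 0"
  using assms inf_mono[of a' a b' b] by (intro order.antisym) auto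

lemma inf_scaleR_eq_0:
  fixes a b :: "'a::vector_lattice"
  assumes "0 \<le> a" "0 \<le> b" "inf a b = 0" "0 \<le> k"
  shows "inf a (k *\<^sub>R b) = 0"
proof (rule inf_eq_0_mono)
  \<comment> \<open>The factor \<open>k + 1\<close> is positive even for \<open>k = 0\<close> and
    dominates both 1 and \<open>k\<close>.\<close>
  have "(k + 1) *\<^sub>R inf a b = inf ((k + 1) *\<^sub>R a) ((k + 1) *\<^sub>R b)"
    using assms by (intro scaleR_inf_pos) auto
  then show "inf ((k + 1) *\<^sub>R a) ((k + 1) *\<^sub>R b) = 0"
    using assms by simp
  show "a \<le> (k + 1) *\<^sub>R a"
    using assms by (simp add: scaleR_add_left scaleR_nonneg_nonneg)
  show "k *\<^sub>R b \<le> (k + 1) *\<^sub>R b"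
    using assms by (simp add: scaleR_add_left)
qed (use assms in \<open>auto simp: scaleR_nonneg_nonneg\<close>)

text \<open>Identifies the complement of \<open>inf a b\<close> in \<open>b\<close> with the excess
  of \<open>b\<close> over \<open>a\<close>, so that component conditions become disjointness from a
  positive part.\<close>

lemma diff_inf_eq_pprt:
  fixes a b :: "'a::lattice_ab_group_add"
  shows "b - inf a b = pprt (b - a)"
  by (simp add: diff_inf_eq_sup pprt_def add_sup_distrib_left)

text \<open>Since \<open>pprt x = x - nprt x\<close> and \<open>nprt\<close> is monotone,
  \<open>pprt a\<close> and \<open>pprt b\<close> lie below the translates of \<open>a\<close> and
  \<open>b\<close> by the same element \<open>- nprt (inf a b)\<close>, and translations commute
  with \<open>inf\<close>.\<close>

lemma pprt_inf:
  fixes a b :: "'a::lattice_ab_group_add"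
  shows "pprt (inf a b) = inf (pprt a) (pprt b)"
proof (rule order.antisym)
  show "pprt (inf a b) \<le> inf (pprt a) (pprt b)"
    by simp
  have "pprt a \<le> a - nprt (inf a b)" "pprt b \<le> b - nprt (inf a b)"
    using prts[of a] prts[of b] add_left_mono[OF nprt_mono[OF inf_le1[of a b]], of "pprt a"]
      add_left_mono[OF nprt_mono[OF inf_le2[of a b]], of "pprt b"]
    by (simp_all add: le_diff_eq)
  then have "inf (pprt a) (pprt b) \<le> inf a b - nprt (inf a b)"
    using add_inf_distrib_right[of a b "- nprt (inf a b)"]
    by (simp add: le_infI1 le_infI2)
  also have "\<dots> = pprt (inf a b)"
    using prts[of "inf a b"] by (simp add: algebra_simps)
  finally show "inf (pprt a) (pprt b) \<le> pprt (inf a b)" .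
qed

text \<open>\<open>- g1\<close> lies below \<open>g2\<close>, hence below multiples of both of the
  disjoint elements \<open>w1\<close> and \<open>w2\<close>, hence below 0.\<close>

lemma nonneg_of_disjoint_sum_nonneg:
  fixes g1 g2 :: "'a::vector_lattice"
  assumes "0 \<le> g1 + g2" "- (m *\<^sub>R w1) \<le> g1" "g2 \<le> n *\<^sub>R w2" "inf w1 w2 = 0" "0 \<le> m" "0 \<le> n"
  shows "0 \<le> g1"
proof -
  have w: "0 \<le> w1" "0 \<le> w2"
    using \<open>inf w1 w2 = 0\<close> inf_le1 inf_le2 by metis+
  have "- g1 \<le> g2"
    using add_left_mono[OF assms(1), of "- g1"] by simp
  then have "- g1 \<le> n *\<^sub>R w2" "- g1 \<le> m *\<^sub>R w1"
    using assms(3) minus_le_iff[of "m *\<^sub>R w1" g1] assms(2) by (auto simp: minus_le_iff)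
  then have "- g1 \<le> inf (m *\<^sub>R w1) (n *\<^sub>R w2)"
    by simp
  also have "inf (m *\<^sub>R w1) w2 = 0"
    using inf_scaleR_eq_0[of w2 w1 m] assms w by (simp add: inf_commute)
  then have "inf (m *\<^sub>R w1) (n *\<^sub>R w2) = 0"
    using assms w by (intro inf_scaleR_eq_0) (auto simp: scaleR_nonneg_nonneg)
  finally show ?thesis
    by simp
qed

text \<open>The layer of \<open>g\<close> between heights \<open>a\<close> and \<open>b\<close>,
  measured upwards from \<open>a\<close>: the element cut off on the right stays fixed while
  \<open>b\<close> varies.\<close>

lemma inf_scaleR_diff:
  fixes g u :: "'a::vector_lattice"
  assumes "0 \<le> u" "a \<le> b"
  shows "inf g (b *\<^sub>R u) - inf g (a *\<^sub>R u) = inf (pprt (g - a *\<^sub>R u)) ((b - a) *\<^sub>R u)"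
proof -
  have "inf (a *\<^sub>R u) (inf g (b *\<^sub>R u)) = inf g (a *\<^sub>R u)"
    using assms by (metis inf.absorb2 inf.left_commute inf.commute scaleR_right_mono)
  then have "inf g (b *\<^sub>R u) - inf g (a *\<^sub>R u) = pprt (inf g (b *\<^sub>R u) - a *\<^sub>R u)"
    using diff_inf_eq_pprt[of "inf g (b *\<^sub>R u)" "a *\<^sub>R u"] by simp
  also have "inf g (b *\<^sub>R u) - a *\<^sub>R u = inf (g - a *\<^sub>R u) ((b - a) *\<^sub>R u)"
    using add_inf_distrib_right[of g "b *\<^sub>R u" "- (a *\<^sub>R u)"] by (simp add: scaleR_diff_left)
  also have "pprt \<dots> = inf (pprt (g - a *\<^sub>R u)) ((b - a) *\<^sub>R u)"
    using assms by (simp add: pprt_inf scaleR_nonneg_nonneg)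
  finally show ?thesis .
qed

text \<open>The same layer measured downwards from \<open>b\<close>, as full height minus the
  deficit of \<open>g\<close> below \<open>b\<close>: now the element cut off stays fixed while
  \<open>a\<close> varies.\<close>

lemma inf_scaleR_diff':
  fixes g u :: "'a::vector_lattice"
  assumes "0 \<le> u" "a \<le> b"
  shows "inf g (b *\<^sub>R u) - inf g (a *\<^sub>R u)
    = (b - a) *\<^sub>R u - inf (pprt (b *\<^sub>R u - g)) ((b - a) *\<^sub>R u)"
proof -
  have "(b - a) *\<^sub>R u - pprt (b *\<^sub>R u - g) = inf (g - a *\<^sub>R u) ((b - a) *\<^sub>R u)"
    by (simp add: pprt_def diff_sup_eq_inf add_inf_distrib_left algebra_simps)
  then have "(b - a) *\<^sub>R u - inf (pprt (b *\<^sub>R u - g)) ((b - a) *\<^sub>R u)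
    = pprt (inf (g - a *\<^sub>R u) ((b - a) *\<^sub>R u))"
    by (simp add: diff_inf_eq_pprt)
  also have "\<dots> = inf (pprt (g - a *\<^sub>R u)) ((b - a) *\<^sub>R u)"
    using assms by (simp add: pprt_inf scaleR_nonneg_nonneg)
  finally show ?thesis
    using inf_scaleR_diff[OF assms] by simp
qed

section \<open>Unital components\<close>

context trunc
begin

lemma trunc_mono:
  assumes "0 \<le> f" "f \<le> g"
  shows "t f \<le> t g"
  using assms inf_trunc_le[of g f] trunc_le[of f] by (simp add: inf.absorb2 order.trans)

lemma truncated_iff: "f \<in> truncated_elements t \<longleftrightarrow> 0 \<le> f \<and> t f = f"
proof
  assume "f \<in> truncated_elements t"
  then obtain h where "0 \<le> h" "f = t h"
    by (auto simp: truncated_elements_def)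
  \<comment> \<open>For \<open>f = t h\<close>, the axiom \<open>inf_trunc_le\<close> at
    \<open>f\<close> and \<open>h\<close> reads \<open>f \<le> t f\<close>.\<close>
  then show "0 \<le> f \<and> t f = f"
    using inf_trunc_le[of f h] trunc_nonneg[of h] trunc_le[of f] by auto
qed (auto simp: truncated_elements_def image_iff intro!: exI[of _ f])

lemma truncated_downward:
  assumes "g \<in> truncated_elements t" "0 \<le> f" "f \<le> g"
  shows "f \<in> truncated_elements t"
  using assms inf_trunc_le[of f g] trunc_le[of f]
  by (auto simp: truncated_iff inf.absorb1 intro: order.antisym)

lemma truncated_sup:
  assumes "f \<in> truncated_elements t" "g \<in> truncated_elements t"
  shows "sup f g \<in> truncated_elements t"
proof -
  have nn: "0 \<le> sup f g"
    using assms by (simp add: truncated_iff le_supI1)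
  have "sup f g \<le> t (sup f g)"
    using assms trunc_mono[of f "sup f g"] trunc_mono[of g "sup f g"] by (simp add: truncated_iff)
  then show ?thesis
    using trunc_le[OF nn] nn by (simp add: truncated_iff order.antisym)
qed

text \<open>In the function picture, no truncated element exceeds \<open>u\<close> where
  \<open>u\<close> is nonzero. The excess of \<open>g\<close> over \<open>u\<close> lies below
  \<open>g\<close>, so the meet with \<open>g\<close> drops out of the component condition.\<close>

lemma unital_iff:
  "u \<in> unital_components t \<longleftrightarrow>
    u \<in> truncated_elements t \<and> (\<forall>g\<in>truncated_elements t. inf u (pprt (g - u)) = 0)"
proof -
  have "is_component (inf u g) g \<longleftrightarrow> inf u (pprt (g - u)) = 0"
    if "u \<in> truncated_elements t" "g \<in> truncated_elements t" for g
  proof -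
    have nn: "0 \<le> u" "0 \<le> g"
      using that by (auto simp: truncated_iff)
    then have "pprt (g - u) \<le> g"
      by (simp add: pprt_def)
    then have "inf (inf u g) (pprt (g - u)) = inf u (pprt (g - u))"
      by (simp add: inf.absorb2 inf.assoc)
    then show ?thesis
      using nn by (simp add: is_component_def diff_inf_eq_pprt)
  qed
  then show ?thesis
    by (auto simp: unital_components_def)
qed

lemma unital_truncated: "u \<in> unital_components t \<Longrightarrow> u \<in> truncated_elements t"
  by (simp add: unital_iff)

lemma unital_nonneg: "u \<in> unital_components t \<Longrightarrow> 0 \<le> u"
  by (simp add: unital_iff truncated_iff)

lemma unital_0: "0 \<in> unital_components t"
  using trunc_nonneg[of 0] trunc_le[of 0]
  by (auto simp: unital_iff truncated_iff inf_absorb1)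

text \<open>The excess of \<open>g\<close> over \<open>inf u v\<close> is at most the sum of its
  excesses over \<open>u\<close> and over \<open>v\<close>, and \<open>inf u v\<close> is disjoint
  from both.\<close>

lemma unital_inf:
  assumes u: "u \<in> unital_components t" and v: "v \<in> unital_components t"
  shows "inf u v \<in> unital_components t"
  unfolding unital_iff
proof (intro conjI ballI)
  have nn: "0 \<le> inf u v"
    using u v by (simp add: unital_nonneg)
  show "inf u v \<in> truncated_elements t"
    using truncated_downward[OF unital_truncated[OF u] nn] by simp
  fix g assume g: "g \<in> truncated_elements t"
  have "inf (inf u v) (pprt (g - u)) = 0" "inf (inf u v) (pprt (g - v)) = 0"
    using u v g nn
    by (auto intro: inf_eq_0_mono[of u "pprt (g - u)"] inf_eq_0_mono[of v "pprt (g - v)"]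
        simp: unital_iff)
  then have "inf (inf u v) (pprt (g - u) + pprt (g - v)) = 0"
    using nn by (intro inf_add_eq_0) auto
  moreover have "pprt (g - inf u v) \<le> pprt (g - u) + pprt (g - v)"
  proof -
    have "g - u \<le> pprt (g - u)" "g - v \<le> pprt (g - v)"
      by (simp_all add: pprt_def)
    then have "g - u \<le> pprt (g - u) + pprt (g - v)" "g - v \<le> pprt (g - u) + pprt (g - v)"
      by (metis add_increasing add_increasing2 zero_le_pprt)+
    moreover have "g - inf u v = sup (g - u) (g - v)"
      by (simp add: diff_inf_eq_sup add_sup_distrib_left)
    ultimately show ?thesis
      by (simp add: pprt_def le_supI1)
  qed
  ultimately show "inf (inf u v) (pprt (g - inf u v)) = 0"
    using nn by (auto intro: inf_eq_0_mono)
qed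

lemma unital_disjoint_diff:
  assumes "u \<in> unital_components t" "v \<in> unital_components t"
  shows "inf u (v - inf u v) = 0"
  using assms by (auto simp: diff_inf_eq_pprt unital_iff)

text \<open>The excess of \<open>g\<close> over the complement of \<open>u\<close> in
  \<open>v\<close> is at most its excess over \<open>v\<close> plus \<open>inf u v\<close>, and the
  complement is disjoint from both.\<close>

lemma unital_diff:
  assumes u: "u \<in> unital_components t" and v: "v \<in> unital_components t"
  shows "v - inf u v \<in> unital_components t"
  unfolding unital_iff
proof (intro conjI ballI)
  let ?q = "v - inf u v"
  have nn: "0 \<le> ?q" "?q \<le> v"
    using u v by (simp_all add: unital_nonneg)
  show "?q \<in> truncated_elements t"
    using truncated_downward[OF unital_truncated[OF v]] nn by simp
  fix g assume g: "g \<in> truncated_elements t"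
  have uv: "0 \<le> inf u v"
    using u v by (simp add: unital_nonneg)
  have "inf ?q (pprt (g - v)) = 0"
    using v g nn by (auto intro: inf_eq_0_mono[of v "pprt (g - v)"] simp: unital_iff)
  moreover have "inf ?q (inf u v) = 0"
    using unital_disjoint_diff[OF u v] uv nn
    by (subst inf_commute) (auto intro: inf_eq_0_mono[of u ?q])
  ultimately have "inf ?q (pprt (g - v) + inf u v) = 0"
    using nn uv by (intro inf_add_eq_0) auto
  moreover have "pprt (g - ?q) \<le> pprt (g - v) + inf u v"
  proof -
    have "g - v \<le> pprt (g - v)"
      by (simp add: pprt_def)
    then have "g - ?q \<le> pprt (g - v) + inf u v"
      by (simp add: algebra_simps)
    then show ?thesis
      using uv by (simp add: pprt_def[of "g - ?q"])
  qed
  ultimately show "inf ?q (pprt (g - ?q)) = 0"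
    using nn by (auto intro: inf_eq_0_mono)
qed

text \<open>By disjointness the sum is a supremum, hence truncated; the excess over it is at most
  the excess over either summand.\<close>

lemma unital_add:
  assumes u: "u \<in> unital_components t" and v: "v \<in> unital_components t" and "inf u v = 0"
  shows "u + v \<in> unital_components t"
  unfolding unital_iff
proof (intro conjI ballI)
  have nn: "0 \<le> u" "0 \<le> v"
    using u v by (simp_all add: unital_nonneg)
  have "u + v = sup u v"
    using add_eq_inf_sup[of u v] \<open>inf u v = 0\<close> by simp
  then show "u + v \<in> truncated_elements t"
    using truncated_sup[OF unital_truncated[OF u] unital_truncated[OF v]] by simp
  fix g assume g: "g \<in> truncated_elements t"
  let ?p = "pprt (g - (u + v))"
  have le: "?p \<le> pprt (g - u)" "?p \<le> pprt (g - v)"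
    using nn by (auto intro!: pprt_mono diff_left_mono)
  have "inf u ?p = 0" "inf v ?p = 0"
    using u v g nn le
    by (auto intro: inf_eq_0_mono[of u "pprt (g - u)"] inf_eq_0_mono[of v "pprt (g - v)"]
        simp: unital_iff)
  then show "inf (u + v) ?p = 0"
    using nn inf_add_eq_0[of ?p u v] by (simp add: inf_commute)
qed

text \<open>The part of \<open>t h\<close> above \<open>u\<close> is disjoint from \<open>u\<close> but bounded by a multiple of it.\<close>

lemma trunc_eq_unital:
  assumes u: "u \<in> unital_components t" and h: "u \<le> h" "h \<le> c *\<^sub>R u"
  shows "t h = u"
proof -
  have nn: "0 \<le> u" "0 \<le> h"
    using unital_nonneg[OF u] h by auto
  have "u \<le> t h"
    using trunc_mono[OF nn(1) h(1)] unital_truncated[OF u] by (simp add: truncated_iff)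
  moreover have "t h \<in> truncated_elements t"
    using nn by (auto simp: truncated_elements_def)
  ultimately have "inf u (t h - u) = 0"
    using u unfolding unital_iff by force
  then have "inf (t h - u) (\<bar>c\<bar> *\<^sub>R u) = 0"
    using nn \<open>u \<le> t h\<close> by (intro inf_scaleR_eq_0) (auto simp: inf_commute)
  moreover have "t h - u \<le> \<bar>c\<bar> *\<^sub>R u"
  proof -
    have "t h - u \<le> h"
      using trunc_le[OF nn(2)] nn by (simp add: diff_le_eq add_increasing2)
    also have "\<dots> \<le> \<bar>c\<bar> *\<^sub>R u"
      using h(2) nn by (meson abs_ge_self order_trans scaleR_right_mono)
    finally show ?thesis .
  qed
  ultimately show ?thesis
    by (simp add: inf.absorb1)
qed

section \<open>Step functions\<close>

text \<open>Normal form of a simple function: a linear combination of pairwise disjoint unital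
  components. The first argument is their sum and acts as a carrier; coefficients may be 0, so the
  carrier can grow while the function stays the same.\<close>

inductive step :: "'a \<Rightarrow> 'a \<Rightarrow> bool" where
  scaled: "u \<in> unital_components t \<Longrightarrow> step u (r *\<^sub>R u)"
| disjoint: "step u f \<Longrightarrow> step v g \<Longrightarrow> inf u v = 0 \<Longrightarrow> step (u + v) (f + g)"

lemma step_unital: "step w g \<Longrightarrow> w \<in> unital_components t"
  by (induction rule: step.induct) (auto intro: unital_add)

lemma step_bounds:
  assumes "step w g"
  shows "\<exists>n::nat. - (real n *\<^sub>R w) \<le> g \<and> g \<le> real n *\<^sub>R w"
  using assms
proof (induction rule: step.induct)
  case (scaled u r)
  obtain n :: nat where n: "\<bar>r\<bar> \<le> real n"
    using real_arch_simple by blast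
  have "(- real n) *\<^sub>R u \<le> r *\<^sub>R u" "r *\<^sub>R u \<le> real n *\<^sub>R u"
    using n unital_nonneg[OF scaled] by (intro scaleR_right_mono; simp)+
  then show ?case
    by auto
next
  case (disjoint u f v g)
  then obtain m n :: nat where
    b: "- (real m *\<^sub>R u) \<le> f" "f \<le> real m *\<^sub>R u" "- (real n *\<^sub>R v) \<le> g" "g \<le> real n *\<^sub>R v"
    by blast
  have "real m *\<^sub>R u \<le> real (m + n) *\<^sub>R u" "real n *\<^sub>R v \<le> real (m + n) *\<^sub>R v"
    using disjoint.hyps by (auto intro!: scaleR_right_mono unital_nonneg step_unital)
  then have "- (real (m + n) *\<^sub>R u) + - (real (m + n) *\<^sub>R v) \<le> f + g"
    "f + g \<le> real (m + n) *\<^sub>R u + real (m + n) *\<^sub>R v"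
    using b by (meson add_mono neg_le_iff_le order_trans)+
  then show ?case
    by (intro exI[of _ "m + n"]) (simp add: scaleR_add_right)
qed

text \<open>The witness \<open>v\<close> is the sum of the components with positive coefficients.
  The bound \<open>v \<le> w\<close> keeps the witnesses of disjoint parts disjoint in the
  induction.\<close>

lemma step_nonneg_equivalent:
  assumes "step w g" "0 \<le> g"
  shows "\<exists>v\<in>unital_components t. v \<le> w \<and>
    (\<exists>n::nat. 0 < n \<and> v \<le> real n *\<^sub>R g \<and> g \<le> real n *\<^sub>R v)"
  using assms
proof (induction rule: step.induct)
  case (scaled u r)
  have u: "0 \<le> u"
    using scaled by (simp add: unital_nonneg)
  show ?case
  proof (cases "r \<le> 0")
    \<comment> \<open>A nonpositive coefficient forces the nonnegative term to vanish, so the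
      witness is 0 rather than \<open>u\<close>.\<close>
    case True
    then have "r *\<^sub>R u = 0"
      using u scaled.prems by (intro order.antisym scaleR_nonpos_nonneg)
    then show ?thesis
      using unital_0 u by (intro bexI[of _ 0]) auto
  next
    case False
    obtain n :: nat where n: "max r (inverse r) \<le> real n"
      using real_arch_simple by blast
    then have "1 \<le> real n * r" "0 < n"
      using False by (auto simp: field_simps intro: gr0I)
    then show ?thesis
      using scaled u n scaleR_right_mono[of 1 "real n * r" u] scaleR_right_mono[of r "real n" u]
      by (intro bexI[of _ u]) auto
  qed
next
  case (disjoint u f v g)
  obtain m n :: nat where
    b: "- (real m *\<^sub>R u) \<le> f" "f \<le> real m *\<^sub>R u" "- (real n *\<^sub>R v) \<le> g" "g \<le> real n *\<^sub>R v"
    using disjoint.hyps step_bounds by meson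
  \<comment> \<open>Only the sum is known to be nonnegative; disjoint carriers pass this on to each
    summand, as the induction hypotheses require.\<close>
  have "0 \<le> f" "0 \<le> g"
    using nonneg_of_disjoint_sum_nonneg[of f g m u n v]
      nonneg_of_disjoint_sum_nonneg[of g f n v m u] b disjoint
    by (auto simp: add.commute inf_commute)
  then obtain u' v' and k l :: nat where
    u': "u' \<in> unital_components t" "u' \<le> u" "0 < k" "u' \<le> real k *\<^sub>R f" "f \<le> real k *\<^sub>R u'" and
    v': "v' \<in> unital_components t" "v' \<le> v" "0 < l" "v' \<le> real l *\<^sub>R g" "g \<le> real l *\<^sub>R v'"
    using disjoint.IH by blast
  have nn: "0 \<le> u'" "0 \<le> v'"
    using u' v' by (auto simp: unital_nonneg)
  have "inf u' v' = 0"
    using disjoint.hyps nn u' v' by (auto intro: inf_eq_0_mono[of u v])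
  then have "u' + v' \<in> unital_components t"
    using u' v' by (auto intro: unital_add)
  moreover have "u' + v' \<le> real (k + l) *\<^sub>R (f + g)"
  proof -
    have "real k *\<^sub>R f \<le> real (k + l) *\<^sub>R f" "real l *\<^sub>R g \<le> real (k + l) *\<^sub>R g"
      using \<open>0 \<le> f\<close> \<open>0 \<le> g\<close> by (auto intro!: scaleR_right_mono)
    then show ?thesis
      unfolding scaleR_add_right using u' v' by (meson add_mono order_trans)
  qed
  moreover have "f + g \<le> real (k + l) *\<^sub>R (u' + v')"
  proof -
    have "real k *\<^sub>R u' \<le> real (k + l) *\<^sub>R u'" "real l *\<^sub>R v' \<le> real (k + l) *\<^sub>R v'"
      using nn by (auto intro!: scaleR_right_mono)
    then show ?thesis
      unfolding scaleR_add_right using u' v' by (meson add_mono order_trans)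
  qed
  ultimately show ?case
    using u' v' by (intro bexI[of _ "u' + v'"]) (auto intro: add_mono exI[of _ "k + l"])
qed

text \<open>Each component \<open>v\<close> of the carrier splits into \<open>inf u v\<close>, with
  coefficient \<open>r + c\<close>, and \<open>v - inf u v\<close>, with the old coefficient
  \<open>r\<close>.\<close>

lemma step_add_scaled:
  assumes "step w g" "u \<in> unital_components t"
  shows "step w (g + c *\<^sub>R inf u w)"
  using assms
proof (induction rule: step.induct)
  case (scaled v r)
  have disj: "inf (inf u v) (v - inf u v) = 0"
    using unital_disjoint_diff[OF scaled.prems scaled.hyps] scaled
    by (auto intro: inf_eq_0_mono[of u "v - inf u v"] simp: unital_nonneg)
  have "step (inf u v + (v - inf u v)) ((r + c) *\<^sub>R inf u v + r *\<^sub>R (v - inf u v))"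
    using scaled disj by (intro step.intros unital_inf unital_diff)
  then show ?case
    by (simp add: algebra_simps)
next
  case (disjoint v f w g)
  have v: "v \<in> unital_components t" and w: "w \<in> unital_components t"
    using disjoint.hyps step_unital by auto
  then have nn: "0 \<le> u" "0 \<le> v" "0 \<le> w"
    using disjoint.prems by (auto simp: unital_nonneg)
  have "inf u (v + w) = inf u v + inf u w"
  proof (rule order.antisym)
    have "inf (inf u v) (inf u w) = 0"
      using disjoint.hyps nn by (auto intro: inf_eq_0_mono[of v w])
    then have "inf u v + inf u w = sup (inf u v) (inf u w)"
      using add_eq_inf_sup[of "inf u v" "inf u w"] by simp
    then show "inf u v + inf u w \<le> inf u (v + w)"
      using nn by (simp add: le_infI2 add_increasing add_increasing2)
  qed (use nn in \<open>rule inf_add_le\<close>)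
  moreover have "step (v + w) ((f + c *\<^sub>R inf u v) + (g + c *\<^sub>R inf u w))"
    using disjoint by (intro step.disjoint) auto
  ultimately show ?case
    by (simp add: algebra_simps)
qed

lemma span_unital_step:
  assumes "g \<in> span (unital_components t)"
  shows "\<exists>w. step w g"
  using assms
proof (induction rule: real_vector.span_induct_alt)
  case base
  show ?case
    using scaled[OF unital_0, of 0] by auto
next
  case (step c u g)
  then obtain w where w: "step w g"
    by blast
  then have wu: "w \<in> unital_components t"
    by (rule step_unital)
  let ?d = "u - inf w u"
  \<comment> \<open>The part of \<open>u\<close> outside \<open>w\<close> joins the carrier with
    coefficient 0. Then \<open>u\<close> lies below the new carrier, and refinement adds all of
    \<open>c\<close> times \<open>u\<close>.\<close>
  have "step (w + ?d) (g + 0 *\<^sub>R ?d)"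
    using w wu step unital_disjoint_diff[OF wu, of u]
    by (intro step.intros unital_diff) auto
  then have "step (w + ?d) (g + c *\<^sub>R inf u (w + ?d))"
    using step by (intro step_add_scaled) auto
  moreover have "u \<le> w + ?d"
    by (simp add: algebra_simps)
  ultimately show ?case
    by (auto simp: inf.absorb1 add.commute)
qed

section \<open>Simple truncs are bounded and bounded away from zero\<close>

lemma simple_imp_equivalent:
  assumes "simple_trunc t" "0 \<le> g"
  obtains u and n :: nat where "u \<in> unital_components t" "0 < n"
    "u \<le> real n *\<^sub>R g" "g \<le> real n *\<^sub>R u"
proof -
  obtain w where "step w g"
    using assms span_unital_step by (auto simp: simple_trunc_def)
  then show ?thesis
    using step_nonneg_equivalent assms(2) that by blast
qed

lemma simple_imp_bounded:
  assumes "simple_trunc t"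
  shows "bounded_trunc t"
  unfolding bounded_trunc_def
proof (intro allI impI)
  fix g :: 'a assume "0 \<le> g"
  then obtain u and n :: nat where u: "u \<in> unital_components t" and n: "0 < n"
    and le: "u \<le> real n *\<^sub>R g" "g \<le> real n *\<^sub>R u"
    using assms simple_imp_equivalent by blast
  \<comment> \<open>Dividing \<open>u\<close> by \<open>n\<close> gives an element below
    \<open>u\<close>, hence truncated, and below \<open>g\<close>; so it lies below
    \<open>t g\<close>. Multiplying by \<open>n * n\<close> then recovers \<open>n\<close> times
    \<open>u\<close>, which dominates \<open>g\<close>.\<close>
  let ?v = "inverse (real n) *\<^sub>R u"
  have v: "0 \<le> ?v" "?v \<le> u" "?v \<le> g"
    using n u le scaleR_right_mono[of "inverse (real n)" 1 u]
      scaleR_left_mono[of u "real n *\<^sub>R g" "inverse (real n)"]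
    by (auto simp: unital_nonneg scaleR_nonneg_nonneg inverse_le_1_iff)
  then have "?v \<le> t g"
    using truncated_downward[OF unital_truncated[OF u]] trunc_mono[of ?v g]
    by (simp add: truncated_iff)
  then have "real (n * n) *\<^sub>R ?v \<le> real (n * n) *\<^sub>R t g"
    by (intro scaleR_left_mono) auto
  then have "real n *\<^sub>R u \<le> real (n * n) *\<^sub>R t g"
    using n by (simp add: mult.assoc)
  then show "\<exists>n::nat. 0 < n \<and> g \<le> real n *\<^sub>R t g"
    using le n by (intro exI[of _ "n * n"]) auto
qed

lemma simple_imp_bounded_away:
  assumes "simple_trunc t"
  shows "trunc_bounded_away t"
  unfolding trunc_bounded_away_def
proof (intro allI impI)
  fix g :: 'a assume g: "0 < g"
  then obtain u and n :: nat where u: "u \<in> unital_components t" and n: "0 < n"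
    and le: "u \<le> real n *\<^sub>R g" "g \<le> real n *\<^sub>R u"
    using assms simple_imp_equivalent by (metis order.strict_implies_order)
  have "real n *\<^sub>R g \<le> (real n * real n) *\<^sub>R u"
    using scaleR_left_mono[OF le(2), of "real n"] by simp
  then have "t (real n *\<^sub>R g) = u"
    using u le by (intro trunc_eq_unital)
  then show "elt_bounded_away t g"
    using g u n by (auto simp: elt_bounded_away_def)
qed

section \<open>Bounded truncs that are bounded away from zero\<close>

text \<open>In the function picture \<open>d\<close> has no values strictly between 0 and some
  \<open>1/n\<close>. With \<open>v = t (n d)\<close>, boundedness puts \<open>k d\<close> between
  \<open>v\<close> and a multiple of \<open>v\<close> for every \<open>k \<ge> n\<close>, so
  \<open>inf (k d) u = v\<close>. Dividing by \<open>k = 1/s\<close> shows that cutting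
  \<open>d\<close> at height \<open>s\<close> leaves \<open>s v\<close>.\<close>

lemma inf_small_multiple_in_span:
  assumes bd: "bounded_trunc t" and ba: "trunc_bounded_away t"
    and u: "u \<in> unital_components t" and d: "0 \<le> d" "d \<le> K *\<^sub>R u"
  shows "\<exists>\<delta>>0. \<forall>s. 0 \<le> s \<and> s < \<delta> \<longrightarrow> inf d (s *\<^sub>R u) \<in> span (unital_components t)"
proof (cases "d = 0")
  case True
  then show ?thesis
    using unital_nonneg[OF u]
    by (intro exI[of _ 1]) (auto simp: inf_absorb1 scaleR_nonneg_nonneg real_vector.span_zero)
next
  case False
  then have "0 < d"
    using d by simp
  then obtain n :: nat where n: "0 < n" and v: "t (real n *\<^sub>R d) \<in> unital_components t"
    using ba unfolding trunc_bounded_away_def elt_bounded_away_def by blast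
  define v where "v = t (real n *\<^sub>R d)"
  have nd: "0 \<le> real n *\<^sub>R d"
    using d by (simp add: scaleR_nonneg_nonneg)
  then obtain M :: nat where M: "real n *\<^sub>R d \<le> real M *\<^sub>R v"
    using bd unfolding bounded_trunc_def v_def by blast
  have u0: "0 \<le> u"
    using u by (rule unital_nonneg)
  have eq: "inf (k *\<^sub>R d) u = v" if k: "real n \<le> k" for k
  proof -
    have kd: "0 \<le> k *\<^sub>R d"
      using d k by (simp add: scaleR_nonneg_nonneg)
    have "t (k *\<^sub>R d) = v"
    proof (rule trunc_eq_unital)
      show "v \<in> unital_components t"
        using v by (simp add: v_def)
      show "v \<le> k *\<^sub>R d"
        using trunc_le[OF nd] scaleR_right_mono[OF k d(1)] by (simp add: v_def)
      show "k *\<^sub>R d \<le> (k / real n * real M) *\<^sub>R v"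
        using scaleR_left_mono[OF M, of "k / real n"] k n by simp
    qed
    moreover have "t (k *\<^sub>R d) \<le> u"
    proof -
      have "k *\<^sub>R d \<le> (k * K) *\<^sub>R u"
        using scaleR_left_mono[OF d(2), of k] k by simp
      \<comment> \<open>The maximum with 1 puts the multiple of \<open>u\<close> above
        \<open>u\<close> itself, so that it truncates to exactly \<open>u\<close>.\<close>
      also have "\<dots> \<le> max 1 (k * K) *\<^sub>R u"
        using u0 by (intro scaleR_right_mono) auto
      finally have "t (k *\<^sub>R d) \<le> t (max 1 (k * K) *\<^sub>R u)"
        using kd by (intro trunc_mono)
      also have "t (max 1 (k * K) *\<^sub>R u) = u"
        using u u0 scaleR_right_mono[of 1 "max 1 (k * K)" u] by (intro trunc_eq_unital) auto
      finally show ?thesis .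
    qed
    moreover have "inf (k *\<^sub>R d) u \<le> t (k *\<^sub>R d)"
      using inf_trunc_le[OF kd u0] unital_truncated[OF u] by (simp add: truncated_iff)
    ultimately show ?thesis
      using trunc_le[OF kd] by (intro order.antisym) auto
  qed
  have "inf d (s *\<^sub>R u) \<in> span (unital_components t)" if s: "0 \<le> s" "s < inverse (real n)" for s
  proof (cases "s = 0")
    case True
    then show ?thesis
      using d by (simp add: inf_absorb2 real_vector.span_zero)
  next
    case False
    then have "real n \<le> inverse s"
      using s n by (simp add: field_simps)
    then have "inf (inverse s *\<^sub>R d) u = v"
      by (rule eq)
    then have "inf d (s *\<^sub>R u) = s *\<^sub>R v"
      using False s scaleR_inf_pos[of s "inverse s *\<^sub>R d" u] by simp
    then show ?thesis
      using v by (simp add: v_def real_vector.span_scale real_vector.span_base)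
  qed
  then show ?thesis
    using n by (intro exI[of _ "inverse (real n)"]) auto
qed

lemma pos_in_span:
  assumes bd: "bounded_trunc t" and ba: "trunc_bounded_away t" and g: "0 < g"
  shows "g \<in> span (unital_components t)"
proof -
  let ?S = "span (unital_components t)"
  obtain m :: nat where m: "0 < m" and u': "t (real m *\<^sub>R g) \<in> unital_components t"
    using ba g unfolding trunc_bounded_away_def elt_bounded_away_def by blast
  define u where "u = t (real m *\<^sub>R g)"
  have u: "u \<in> unital_components t" and u0: "0 \<le> u"
    using u' unital_nonneg by (auto simp: u_def)
  obtain N :: nat where N: "g \<le> real N *\<^sub>R t g"
    using bd g unfolding bounded_trunc_def by (meson order.strict_implies_order)
  have "t g \<le> u"
    unfolding u_def using g m scaleR_right_mono[of 1 "real m" g] by (intro trunc_mono) auto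
  then have gN: "g \<le> real N *\<^sub>R u"
    using N scaleR_left_mono[of "t g" u "real N"] by simp
  have "inf g (real N *\<^sub>R u) - inf g (0 *\<^sub>R u) \<in> ?S"
  \<comment> \<open>\<open>Bolzano\<close> reduces a property of intervals to additivity over
    adjacent intervals (case 2, telescoping) and validity on all short intervals around each point
    \<open>x\<close> (case 3).\<close>
  proof (rule Bolzano[of 0 "real N" "\<lambda>a b. inf g (b *\<^sub>R u) - inf g (a *\<^sub>R u) \<in> ?S"], goal_cases)
    case (2 a b c)
    then show ?case
      using real_vector.span_add[OF 2(2) 2(1)] by (simp only: add_diff_eq diff_add_cancel)
  next
    case x: (3 x)
    have "pprt (g - x *\<^sub>R u) \<le> real N *\<^sub>R u"
      using gN g u0 x
      by (auto simp: pprt_def scaleR_nonneg_nonneg diff_le_eq intro: add_increasing2)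
    then obtain \<delta>1 where \<delta>1: "\<delta>1 > 0"
      "\<And>s. 0 \<le> s \<Longrightarrow> s < \<delta>1 \<Longrightarrow> inf (pprt (g - x *\<^sub>R u)) (s *\<^sub>R u) \<in> ?S"
      using inf_small_multiple_in_span[OF bd ba u, of "pprt (g - x *\<^sub>R u)" "real N"] by auto
    have "pprt (x *\<^sub>R u - g) \<le> x *\<^sub>R u"
      using g u0 x by (auto simp: pprt_def scaleR_nonneg_nonneg)
    then obtain \<delta>2 where \<delta>2: "\<delta>2 > 0"
      "\<And>s. 0 \<le> s \<Longrightarrow> s < \<delta>2 \<Longrightarrow> inf (pprt (x *\<^sub>R u - g)) (s *\<^sub>R u) \<in> ?S"
      using inf_small_multiple_in_span[OF bd ba u, of "pprt (x *\<^sub>R u - g)" x] by auto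
    have "inf g (b *\<^sub>R u) - inf g (a *\<^sub>R u) \<in> ?S"
      if "a \<le> x" "x \<le> b" "b - a < min \<delta>1 \<delta>2" for a b
    proof -
      \<comment> \<open>The interval is split at \<open>x\<close>: the upper layer is measured
        upwards from \<open>x\<close>, the lower one downwards from \<open>x\<close>. Both then
        involve only the two parts of \<open>g - x u\<close> for which \<open>\<delta>1\<close> and
        \<open>\<delta>2\<close> were chosen before \<open>a\<close> and \<open>b\<close>.\<close>
      have "inf g (b *\<^sub>R u) - inf g (x *\<^sub>R u) \<in> ?S"
        unfolding inf_scaleR_diff[OF u0 that(2)] using that by (intro \<delta>1(2)) auto
      moreover have "inf g (x *\<^sub>R u) - inf g (a *\<^sub>R u) \<in> ?S"
        unfolding inf_scaleR_diff'[OF u0 that(1)] using that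
        by (intro real_vector.span_diff[OF real_vector.span_scale[OF real_vector.span_base[OF u]]] \<delta>2(2))
          auto
      ultimately have "(inf g (b *\<^sub>R u) - inf g (x *\<^sub>R u)) + (inf g (x *\<^sub>R u) - inf g (a *\<^sub>R u)) \<in> ?S"
        by (rule real_vector.span_add)
      then show ?thesis
        by (simp only: add_diff_eq diff_add_cancel)
    qed
    then show ?case
      using \<delta>1(1) \<delta>2(1) by (intro exI[of _ "min \<delta>1 \<delta>2"]) auto
  qed simp
  then show ?thesis
    using gN g by (simp add: inf_absorb1 inf_absorb2)
qed

lemma bounded_bounded_away_imp_simple:
  assumes "bounded_trunc t" "trunc_bounded_away t"
  shows "simple_trunc t"
  unfolding simple_trunc_def
proof
  fix g :: 'a
  have *: "h \<in> span (unital_components t)" if "0 \<le> h" for h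
    using pos_in_span[OF assms, of h] that real_vector.span_zero
    by (cases "h = 0") auto
  have "g = pprt g - pprt (- g)"
    using prts[of g] by (simp add: pprt_neg)
  then show "g \<in> span (unital_components t)"
    using real_vector.span_diff[OF *[of "pprt g"] *[of "pprt (- g)"]] by simp
qed

end

theorem theorem8p2p10:
  fixes t :: "'a::archimedean_vector_lattice \<Rightarrow> 'a"
  assumes "trunc t"
  shows "simple_trunc t \<longleftrightarrow> bounded_trunc t \<and> trunc_bounded_away t"
  using trunc.simple_imp_bounded trunc.simple_imp_bounded_away
    trunc.bounded_bounded_away_imp_simple assms by blast

end
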